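(* Let $G$ be a compactly generated locally compact group, let $(\pi,\mathcal H)$ be an orthogonal or unitary representation of $G$, and let $\mu$ be a cohomologically adapted probability measure on $G$. Let $b\in \mathrm{Har}_\mu(G,\pi)$ be a $\mu$-harmonic cocycle. Then $$\overline{\operatorname{span}(b(G))}=\bigcap_{b'}\overline{\operatorname{span}(b'(G))},$$ where $b'$ runs over all $1$-cocycles in $Z^1(G,\pi)$ that have the same class as $b$ in the reduced cohomology $\overline{H}^1(G,\pi)$, i.e. over all $b'\in Z^1(G,\pi)$ with $b'-b\in\overline{B^1(G,\pi)}$.
   Context: Representations are strongly continuous: $(\pi,\mathcal H)$ is a continuous unitary (resp. orthogonal) representation of $G$ on a complex (resp. real) Hilbert space $\mathcal H$. A $1$-cocycle with coefficients in $\pi$ is a continuous map $b:G\to\mathcal H$ with $b(gh)=b(g)+\pi(g)b(h)$ for all $g,h\in G$; $Z^1(G,\pi)$ is the vector space of $1$-cocycles. For $v\in\mathcal H$ let $\partial_v\in Z^1(G,\pi)$ be $\partial_v(g)=\pi(g)v-v$; $B^1(G,\pi)=\{\partial_v: v\in\mathcal H\}$ is the space of coboundaries. $Z^1(G,\pi)$ carries the topology of uniform convergence on compact subsets of $G$, $\overline{B^1(G,\pi)}$ is the closure of $B^1(G,\pi)$ in it, and $\overline{H}^1(G,\pi)=Z^1(G,\pi)/\overline{B^1(G,\pi)}$. Fix a compact symmetric neighbourhood $Q$ of the identity generating $G$ and put $|g|_Q=\min\{n\in\mathbb N: g\in Q^n\}$. A probability measure $\mu$ on $G$ is cohomologically adapted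 if: $\mu$ is symmetric (invariant under $x\mapsto x^{-1}$); $\mu$ is absolutely continuous with respect to Haar measure; the support of $\mu$ generates $G$; and $\int_G |x|_Q^2\,d\mu(x)<\infty$. (This does not depend on the choice of $Q$.) A cocycle $b\in Z^1(G,\pi)$ is $\mu$-harmonic if $\int_G b(x)\,d\mu(x)=0$; $\mathrm{Har}_\mu(G,\pi)$ is the space of $\mu$-harmonic cocycles in $Z^1(G,\pi)$. $\overline{\operatorname{span}(b(G))}$ denotes the norm closure in $\mathcal H$ of the linear span of $\{b(g): g\in G\}$. *)

theory Defs
  imports "HOL-Analysis.Analysis" "HOL-Probability.Probability_Measure"
begin

section \<open>Complex inner product spaces\<close>

text \<open>
  A complex inner product space is presented as a real inner product space with additional complex
  structure; the real inner product is the real part of the complex one, so norm and topology are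
  the usual ones. The form is conjugate-linear in its first argument. A complex Hilbert space is a
  type of sort \<open>{complex_inner, complete_space}\<close>.
\<close>

class complex_inner = real_inner +
  fixes scaleC :: "complex \<Rightarrow> 'a \<Rightarrow> 'a"
    and cinner :: "'a \<Rightarrow> 'a \<Rightarrow> complex"
  assumes scaleC_add_right: "scaleC a (x + y) = scaleC a x + scaleC a y"
    and scaleC_add_left: "scaleC (a + b) x = scaleC a x + scaleC b x"
    and scaleC_scaleC: "scaleC a (scaleC b x) = scaleC (a * b) x"
    and scaleC_of_real: "scaleC (complex_of_real r) x = scaleR r x"
    and cinner_commute: "cinner x y = cnj (cinner y x)"
    and cinner_add_right: "cinner x (y + z) = cinner x y + cinner x z"
    and cinner_scaleC_right: "cinner x (scaleC a y) = a * cinner x y"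
    and Re_cinner: "Re (cinner x y) = inner x y"

instantiation complex :: complex_inner
begin

definition scaleC_complex :: "complex \<Rightarrow> complex \<Rightarrow> complex"
  where "scaleC_complex a x = a * x"

definition cinner_complex :: "complex \<Rightarrow> complex \<Rightarrow> complex"
  where "cinner_complex x y = cnj x * y"

instance
  by standard
    (simp_all add: scaleC_complex_def cinner_complex_def algebra_simps scaleR_conv_of_real
      inner_complex_def)

end

definition cspan :: "'a::complex_inner set \<Rightarrow> 'a set"
  where "cspan = module.span scaleC"

lemma module_scaleC: "module (scaleC :: complex \<Rightarrow> 'a::complex_inner \<Rightarrow> 'a)"
proof
  show "scaleC 1 x = x" for x :: 'a
    using scaleC_of_real[of 1 x] by simp
qed (simp_all add: scaleC_add_right scaleC_add_left scaleC_scaleC)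


section \<open>Bochner integral without separability\<close>

text \<open>
  The library predicate \<^const>\<open>has_bochner_integral\<close> requires a second-countable codomain, whereas
  the Hilbert spaces considered here need not be separable. The clauses are those of the library.
\<close>

definition has_vector_integral ::
    "'a measure \<Rightarrow> ('a \<Rightarrow> 'b::real_normed_vector) \<Rightarrow> 'b \<Rightarrow> bool"
  where "has_vector_integral M f x \<longleftrightarrow>
    f \<in> borel_measurable M \<and>
    (\<exists>s. (\<forall>i. Bochner_Integration.simple_bochner_integrable M (s i)) \<and>
      (\<lambda>i. \<integral>\<^sup>+ y. norm (f y - s i y) \<partial>M) \<longlonglongrightarrow> 0 \<and>
      (\<lambda>i. Bochner_Integration.simple_bochner_integral M (s i)) \<longlonglongrightarrow> x)"

lemma has_vector_integral_iff_has_bochner_integral: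
  fixes f :: "'a \<Rightarrow> 'b::{real_normed_vector, second_countable_topology}"
  shows "has_vector_integral M f x \<longleftrightarrow> has_bochner_integral M f x"
  unfolding has_vector_integral_def has_bochner_integral.simps by blast


section \<open>Groups, word length and measures\<close>

text \<open>
  Topological groups are written additively, as in the library class
  \<^class>\<open>topological_group_add\<close>; commutativity is not assumed.
\<close>

inductive_set generated_subgroup :: "'g::group_add set \<Rightarrow> 'g set" for S
  where
    zero: "0 \<in> generated_subgroup S"
  | base: "s \<in> S \<Longrightarrow> s \<in> generated_subgroup S"
  | add: "\<lbrakk>s \<in> generated_subgroup S; t \<in> generated_subgroup S\<rbrakk> \<Longrightarrow> s + t \<in> generated_subgroup S"
  | uminus: "s \<in> generated_subgroup S \<Longrightarrow> - s \<in> generated_subgroup S"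

definition compact_generating_nbhd :: "'g::{topological_group_add, t2_space} set \<Rightarrow> bool"
  where "compact_generating_nbhd Q \<longleftrightarrow>
    compact Q \<and> uminus ` Q = Q \<and> 0 \<in> interior Q \<and> generated_subgroup Q = UNIV"

primrec set_power :: "'g::group_add set \<Rightarrow> nat \<Rightarrow> 'g set"
  where
    "set_power Q 0 = {0}"
  | "set_power Q (Suc n) = {x + y | x y. x \<in> Q \<and> y \<in> set_power Q n}"

definition word_length :: "'g::group_add set \<Rightarrow> 'g \<Rightarrow> nat"
  where "word_length Q g = (LEAST n. g \<in> set_power Q n)"

definition left_haar_measure :: "'g::{topological_group_add, t2_space} measure \<Rightarrow> bool"
  where "left_haar_measure \<nu> \<longleftrightarrow>
    sets \<nu> = sets borel \<and>
    emeasure \<nu> UNIV \<noteq> 0 \<and>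
    (\<forall>g. distr \<nu> borel (\<lambda>x. g + x) = \<nu>) \<and>
    (\<forall>K. compact K \<longrightarrow> emeasure \<nu> K < \<infinity>) \<and>
    (\<forall>A \<in> sets borel. emeasure \<nu> A = (INF U \<in> {U. open U \<and> A \<subseteq> U}. emeasure \<nu> U)) \<and>
    (\<forall>U. open U \<longrightarrow> emeasure \<nu> U = (SUP K \<in> {K. compact K \<and> K \<subseteq> U}. emeasure \<nu> K))"

definition measure_support :: "'g::topological_space measure \<Rightarrow> 'g set"
  where "measure_support \<mu> = {x. \<forall>U. open U \<and> x \<in> U \<longrightarrow> emeasure \<mu> U > 0}"

definition cohomologically_adapted ::
    "'g::{topological_group_add, t2_space} set \<Rightarrow> 'g measure \<Rightarrow> 'g measure \<Rightarrow> bool"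
  where "cohomologically_adapted Q \<nu> \<mu> \<longleftrightarrow>
    prob_space \<mu> \<and> sets \<mu> = sets borel \<and>
    distr \<mu> borel uminus = \<mu> \<and>
    absolutely_continuous \<nu> \<mu> \<and>
    generated_subgroup (measure_support \<mu>) = UNIV \<and>
    integrable \<mu> (\<lambda>x. (real (word_length Q x))\<^sup>2)"


section \<open>Representations and cocycles\<close>

definition orthogonal_representation ::
    "('g::topological_group_add \<Rightarrow> 'h::real_inner \<Rightarrow> 'h) \<Rightarrow> bool"
  where "orthogonal_representation \<pi> \<longleftrightarrow>
    (\<forall>g. linear (\<pi> g) \<and> surj (\<pi> g) \<and> (\<forall>v w. inner (\<pi> g v) (\<pi> g w) = inner v w)) \<and>
    \<pi> 0 = id \<and> (\<forall>g h. \<pi> (g + h) = \<pi> g \<circ> \<pi> h) \<and>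
    (\<forall>v. continuous_on UNIV (\<lambda>g. \<pi> g v))"

definition unitary_representation ::
    "('g::topological_group_add \<Rightarrow> 'h::complex_inner \<Rightarrow> 'h) \<Rightarrow> bool"
  where "unitary_representation \<pi> \<longleftrightarrow>
    (\<forall>g. module_hom scaleC scaleC (\<pi> g) \<and> surj (\<pi> g) \<and>
      (\<forall>v w. cinner (\<pi> g v) (\<pi> g w) = cinner v w)) \<and>
    \<pi> 0 = id \<and> (\<forall>g h. \<pi> (g + h) = \<pi> g \<circ> \<pi> h) \<and>
    (\<forall>v. continuous_on UNIV (\<lambda>g. \<pi> g v))"

definition cocycles ::
    "('g::topological_group_add \<Rightarrow> 'h::real_normed_vector \<Rightarrow> 'h) \<Rightarrow> ('g \<Rightarrow> 'h) set"
  where "cocycles \<pi> = {b. continuous_on UNIV b \<and> (\<forall>g h. b (g + h) = b g + \<pi> g (b h))}"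

definition coboundary ::
    "('g \<Rightarrow> 'h::real_normed_vector \<Rightarrow> 'h) \<Rightarrow> 'h \<Rightarrow> 'g \<Rightarrow> 'h"
  where "coboundary \<pi> v g = \<pi> g v - v"

definition coboundaries ::
    "('g \<Rightarrow> 'h::real_normed_vector \<Rightarrow> 'h) \<Rightarrow> ('g \<Rightarrow> 'h) set"
  where "coboundaries \<pi> = range (coboundary \<pi>)"

text \<open>The topology of uniform convergence on compact sets, on all functions.\<close>

definition compact_convergence :: "('g::topological_space \<Rightarrow> 'h::metric_space) topology"
  where "compact_convergence = topology (\<lambda>U. \<forall>f \<in> U. \<exists>K e. compact K \<and> 0 < e \<and>
    {f'. \<forall>x \<in> K. dist (f' x) (f x) < e} \<subseteq> U)"

lemma openin_compact_convergence:
  fixes U :: "('g::topological_space \<Rightarrow> 'h::metric_space) set"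
  shows "openin compact_convergence U \<longleftrightarrow> (\<forall>f \<in> U. \<exists>K e. compact K \<and> 0 < e \<and>
    {f'. \<forall>x \<in> K. dist (f' x) (f x) < e} \<subseteq> U)"
proof -
  define nbhd :: "('g \<Rightarrow> 'h) \<Rightarrow> ('g \<Rightarrow> 'h) set \<Rightarrow> bool"
    where "nbhd f U \<longleftrightarrow> (\<exists>K e. compact K \<and> 0 < e \<and>
      {f'. \<forall>x \<in> K. dist (f' x) (f x) < e} \<subseteq> U)" for f U
  have int: "nbhd f (S \<inter> T)" if S: "nbhd f S" and T: "nbhd f T" for f S T
  proof -
    obtain K e where "compact K" "0 < e" and K: "{f'. \<forall>x \<in> K. dist (f' x) (f x) < e} \<subseteq> S"
      using S unfolding nbhd_def by auto
    obtain L d where "compact L" "0 < d" and L: "{f'. \<forall>x \<in> L. dist (f' x) (f x) < d} \<subseteq> T"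
      using T unfolding nbhd_def by auto
    have "compact (K \<union> L)" "0 < min e d"
      using \<open>compact K\<close> \<open>compact L\<close> \<open>0 < e\<close> \<open>0 < d\<close> by auto
    moreover have "{f'. \<forall>x \<in> K \<union> L. dist (f' x) (f x) < min e d} \<subseteq> S \<inter> T"
      using subsetD[OF K] subsetD[OF L] by simp blast
    ultimately show ?thesis
      unfolding nbhd_def by blast
  qed
  have mono: "nbhd f T" if "nbhd f S" "S \<subseteq> T" for f S T
    using that unfolding nbhd_def by (meson subset_trans)
  have "istopology (\<lambda>U. \<forall>f \<in> U. nbhd f U)"
    unfolding istopology_def by (intro conjI allI impI ballI) (auto intro: int mono)
  then show ?thesis
    unfolding compact_convergence_def nbhd_def by simp
qed

definition closed_coboundaries ::
    "('g::topological_group_add \<Rightarrow> 'h::real_normed_vector \<Rightarrow> 'h) \<Rightarrow> ('g \<Rightarrow> 'h) set"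
  where "closed_coboundaries \<pi> =
    subtopology compact_convergence (cocycles \<pi>) closure_of coboundaries \<pi>"

definition same_reduced_class ::
    "('g::topological_group_add \<Rightarrow> 'h::real_normed_vector \<Rightarrow> 'h) \<Rightarrow> ('g \<Rightarrow> 'h) \<Rightarrow> ('g \<Rightarrow> 'h) \<Rightarrow> bool"
  where "same_reduced_class \<pi> b b' \<longleftrightarrow> (\<lambda>g. b' g - b g) \<in> closed_coboundaries \<pi>"

definition harmonic_cocycles ::
    "'g::topological_group_add measure \<Rightarrow> ('g \<Rightarrow> 'h::real_normed_vector \<Rightarrow> 'h) \<Rightarrow> ('g \<Rightarrow> 'h) set"
  where "harmonic_cocycles \<mu> \<pi> = {b \<in> cocycles \<pi>. has_vector_integral \<mu> b 0}"

end

theory Submission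
  imports Defs
begin

text \<open>
  The cocycle \<open>b\<close> is in its own reduced class, so only one inclusion has content: if \<open>b' - b\<close> is a
  limit of coboundaries, then \<open>b\<close> takes its values in \<open>W = closure (span (range b'))\<close>.
  By the cocycle identity \<open>W\<close> is invariant under the representation, so the orthogonal projection
  \<open>P\<close> onto the complement of \<open>W\<close> commutes with it. Since \<open>P b' = 0\<close>, the cocycle \<open>P b\<close> equals
  \<open>- P (b' - b)\<close>: it is harmonic, and at the same time a limit of coboundaries. It remains to see
  that such a cocycle vanishes.

  This is an orthogonality argument in \<open>L\<^sup>2(\<mu>)\<close>. For a harmonic cocycle \<open>h\<close> the cocycle identity and
  the symmetry of \<open>\<mu>\<close> make \<open>h\<close> orthogonal to every coboundary
  (\<open>harmonic_cocycle_orthogonal_coboundary\<close>). A cocycle grows at most linearly in the word length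
  (\<open>cocycle_norm_le_word_length\<close>), so, as \<open>\<mu>\<close> has a finite second moment, approximation by
  coboundaries uniformly on the generating set \<open>Q\<close> implies approximation in \<open>L\<^sup>2(\<mu>)\<close>. Hence a
  harmonic limit of coboundaries is orthogonal to itself and vanishes \<open>\<mu>\<close>-almost everywhere; by
  continuity it vanishes on the support of \<open>\<mu>\<close>, which generates the group
  (\<open>harmonic_limit_of_coboundaries_eq_0\<close>).

  The unitary case follows from the orthogonal one: the real part of the complex inner product is
  the real inner product, so a unitary representation is orthogonal, and the closed complex span
  contains the closed real span.
\<close>

section \<open>Orthogonal projection in a Hilbert space\<close>

lemma subspace_closure:
  fixes S :: "'a::real_normed_vector set"
  assumes S: "subspace S"
  shows "subspace (closure S)"
proof (rule subspaceI)
  show "0 \<in> closure S"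
    using subspace_0[OF S] closure_subset by blast
  show "x + y \<in> closure S" if "x \<in> closure S" "y \<in> closure S" for x y
  proof -
    obtain f g where "\<And>n. f n \<in> S" "f \<longlonglongrightarrow> x" "\<And>n. g n \<in> S" "g \<longlonglongrightarrow> y"
      using \<open>x \<in> closure S\<close> \<open>y \<in> closure S\<close> unfolding closure_sequential by metis
    then show ?thesis
      unfolding closure_sequential
      by (intro exI[of _ "\<lambda>n. f n + g n"]) (auto intro: tendsto_add subspace_add[OF S])
  qed
  show "r *\<^sub>R x \<in> closure S" if x: "x \<in> closure S" for r x
  proof -
    obtain f where "\<And>n. f n \<in> S" "f \<longlonglongrightarrow> x"
      using x unfolding closure_sequential by metis
    then show ?thesis
      unfolding closure_sequential
      by (intro exI[of _ "\<lambda>n. r *\<^sub>R f n"]) (auto intro: tendsto_scaleR subspace_scale[OF S])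
  qed
qed

text \<open>
  The foot of the perpendicular is the limit of a minimising sequence for the distance, which is
  Cauchy by the parallelogram law.
\<close>

lemma closed_subspace_orthogonal_decomposition:
  fixes W :: "'a::{real_inner, complete_space} set"
  assumes W: "subspace W" "closed W"
  obtains y where "\<And>w. w \<in> W \<Longrightarrow> inner y w = 0" "x - y \<in> W"
proof -
  define d where "d = infdist x W"
  have ne: "W \<noteq> {}"
    using subspace_0[OF W(1)] by auto
  have d0: "0 \<le> d"
    by (simp add: d_def infdist_nonneg)
  have d_le: "d \<le> norm (x - w)" if "w \<in> W" for w
    using infdist_le[OF that, of x] by (simp add: d_def dist_norm)
  have "\<exists>w\<in>W. dist x w < d + inverse (real (Suc n))" for n
  proof -
    have "Inf (dist x ` W) < d + inverse (real (Suc n))"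
      using ne by (simp add: d_def infdist_def)
    from cInf_lessD[OF _ this] ne show ?thesis
      by auto
  qed
  then obtain s where sW: "\<And>n. s n \<in> W" and s: "\<And>n. norm (x - s n) < d + inverse (real (Suc n))"
    unfolding dist_norm by metis
  define r where "r n = 4 * ((d + inverse (real (Suc n)))\<^sup>2 - d\<^sup>2)" for n
  have r0: "r \<longlonglongrightarrow> 0"
  proof -
    have "r \<longlonglongrightarrow> 4 * ((d + 0)\<^sup>2 - d\<^sup>2)"
      unfolding r_def by (intro tendsto_intros LIMSEQ_inverse_real_of_nat)
    then show ?thesis
      by simp
  qed
  have sr: "(norm (s m - s n))\<^sup>2 \<le> r N" if "N \<le> m" "N \<le> n" for m n N
  proof -
    have bound: "(norm (x - s k))\<^sup>2 \<le> (d + inverse (real (Suc N)))\<^sup>2" if "N \<le> k" for k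
    proof (rule power_mono)
      have "inverse (real (Suc k)) \<le> inverse (real (Suc N))"
        using that by (intro le_imp_inverse_le) auto
      then show "norm (x - s k) \<le> d + inverse (real (Suc N))"
        using s[of k] by linarith
    qed simp
    have "(1/2) *\<^sub>R (s m + s n) \<in> W"
      using W(1) sW by (intro subspace_scale subspace_add) auto
    then have mid: "d\<^sup>2 \<le> (norm (x - (1/2) *\<^sub>R (s m + s n)))\<^sup>2"
      using d_le d0 by (intro power_mono) auto
    have "(norm (s m - s n))\<^sup>2 = 2 * (norm (x - s m))\<^sup>2 + 2 * (norm (x - s n))\<^sup>2
        - 4 * (norm (x - (1/2) *\<^sub>R (s m + s n)))\<^sup>2"
      by (simp add: power2_norm_eq_inner inner_diff_left inner_diff_right inner_add_left
          inner_add_right inner_commute algebra_simps)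
    then show ?thesis
      unfolding r_def using bound[OF that(1)] bound[OF that(2)] mid by argo
  qed
  have "Cauchy s"
  proof (rule metric_CauchyI)
    fix e :: real assume e: "0 < e"
    obtain N where "r N < e\<^sup>2"
      using order_tendstoD(2)[OF r0, of "e\<^sup>2"] e by (auto simp: eventually_sequentially)
    then have "dist (s m) (s n) < e" if "N \<le> m" "N \<le> n" for m n
      using sr[OF that] e by (auto simp: dist_norm intro: power_less_imp_less_base[of _ 2])
    then show "\<exists>N. \<forall>m\<ge>N. \<forall>n\<ge>N. dist (s m) (s n) < e"
      by blast
  qed
  then obtain p where p: "s \<longlonglongrightarrow> p"
    using Cauchy_convergent convergent_def by blast
  have pW: "p \<in> W"
    using closed_sequentially[OF W(2) _ p] sW by blast
  have "norm (x - p) \<le> d"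
  proof (rule LIMSEQ_le)
    show "(\<lambda>n. norm (x - s n)) \<longlonglongrightarrow> norm (x - p)"
      by (intro tendsto_intros p)
    show "(\<lambda>n. d + inverse (real (Suc n))) \<longlonglongrightarrow> d"
      using tendsto_add[OF tendsto_const LIMSEQ_inverse_real_of_nat, of d] by simp
    show "\<exists>N. \<forall>n\<ge>N. norm (x - s n) \<le> d + inverse (real (Suc n))"
      using s less_imp_le by blast
  qed
  then have min: "norm (x - p) \<le> norm (x - w)" if "w \<in> W" for w
    using d_le[OF that] by linarith
  have "inner (x - p) w = 0" if w: "w \<in> W" for w
  proof (cases "w = 0")
    case False
    \<comment> \<open>Moving from \<open>p\<close> by the component of \<open>x - p\<close> along \<open>w\<close> would otherwise come closer to \<open>x\<close>.\<close>
    define a t where "a = x - p" and "t = inner a w / inner w w"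
    have ww: "0 < inner w w"
      using False by simp
    have "p + t *\<^sub>R w \<in> W"
      using W(1) pW w by (intro subspace_add subspace_scale) auto
    from min[OF this] have "(norm a)\<^sup>2 \<le> (norm (a - t *\<^sub>R w))\<^sup>2"
      by (intro power_mono) (auto simp: a_def algebra_simps)
    also have "\<dots> = (norm a)\<^sup>2 - 2 * t * inner a w + t * (t * inner w w)"
      by (simp add: power2_norm_eq_inner inner_diff_left inner_diff_right inner_commute algebra_simps)
    also have "t * inner w w = inner a w"
      using ww by (simp add: t_def)
    finally have "t * inner a w \<le> 0"
      by simp
    then have "(inner a w)\<^sup>2 \<le> 0"
      using ww by (simp add: t_def power2_eq_square divide_le_0_iff)
    then show ?thesis
      by (simp add: a_def)
  qed simp
  then show ?thesis
    using that[of "x - p"] pW by simp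
qed

definition orthogonal_part :: "'a::real_inner set \<Rightarrow> 'a \<Rightarrow> 'a"
  where "orthogonal_part W x = (SOME y. (\<forall>w\<in>W. inner y w = 0) \<and> x - y \<in> W)"

context
  fixes W :: "'a::{real_inner, complete_space} set"
  assumes W: "subspace W" "closed W"
begin

lemma inner_orthogonal_part: "w \<in> W \<Longrightarrow> inner (orthogonal_part W x) w = 0"
  and diff_orthogonal_part: "x - orthogonal_part W x \<in> W"
proof -
  have "\<exists>y. (\<forall>w\<in>W. inner y w = 0) \<and> x - y \<in> W"
    using closed_subspace_orthogonal_decomposition[OF W] by metis
  from someI_ex[OF this]
  show "w \<in> W \<Longrightarrow> inner (orthogonal_part W x) w = 0" "x - orthogonal_part W x \<in> W"
    by (auto simp: orthogonal_part_def)
qed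

lemma orthogonal_part_unique:
  assumes "\<And>w. w \<in> W \<Longrightarrow> inner y w = 0" "x - y \<in> W"
  shows "orthogonal_part W x = y"
proof -
  let ?z = "orthogonal_part W x - y"
  have "?z \<in> W"
    using subspace_diff[OF W(1) assms(2) diff_orthogonal_part[of x]] by simp
  then have "inner ?z ?z = 0"
    using assms(1) inner_orthogonal_part by (simp add: inner_diff_left)
  then show ?thesis
    by simp
qed

lemma orthogonal_part_eq_0_iff: "orthogonal_part W x = 0 \<longleftrightarrow> x \<in> W"
  using diff_orthogonal_part[of x] orthogonal_part_unique[of 0 x] by auto

lemma linear_orthogonal_part: "linear (orthogonal_part W)"
proof
  show "orthogonal_part W (x + y) = orthogonal_part W x + orthogonal_part W y" for x y
    using subspace_add[OF W(1) diff_orthogonal_part[of x] diff_orthogonal_part[of y]]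
    by (intro orthogonal_part_unique) (auto simp: inner_add_left inner_orthogonal_part algebra_simps)
  show "orthogonal_part W (r *\<^sub>R x) = r *\<^sub>R orthogonal_part W x" for r x
    using subspace_scale[OF W(1) diff_orthogonal_part[of x], of r]
    by (intro orthogonal_part_unique) (auto simp: inner_orthogonal_part algebra_simps)
qed

lemma orthogonal_part_selfadjoint:
  "inner (orthogonal_part W x) y = inner x (orthogonal_part W y)"
proof -
  have "inner (orthogonal_part W x) y = inner (orthogonal_part W x) (orthogonal_part W y)"
    using inner_orthogonal_part[OF diff_orthogonal_part, of x y] by (simp add: inner_diff_right)
  also have "\<dots> = inner x (orthogonal_part W y)"
    using inner_orthogonal_part[OF diff_orthogonal_part, of y x]
    by (simp add: inner_diff_right inner_commute)
  finally show ?thesis .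
qed

lemma norm_orthogonal_part_le: "norm (orthogonal_part W x) \<le> norm x"
proof -
  let ?y = "orthogonal_part W x"
  have "norm ?y * norm ?y = inner x ?y"
    using inner_orthogonal_part[OF diff_orthogonal_part, of x x]
    by (simp add: inner_diff_right inner_commute flip: power2_eq_square power2_norm_eq_inner)
  also have "\<dots> \<le> norm x * norm ?y"
    by (rule norm_cauchy_schwarz)
  finally show ?thesis
    by (cases "norm ?y = 0") auto
qed

lemma bounded_linear_orthogonal_part: "bounded_linear (orthogonal_part W)"
  using linear_orthogonal_part norm_orthogonal_part_le
  by (intro bounded_linear.intro linear.axioms bounded_linear_axioms.intro)
    (auto simp: linear_def intro: exI[of _ 1])

end


section \<open>Integrals of scalar components\<close>

text \<open>
  For \<open>norm v \<le> 1\<close> the error \<open>\<bar>inner (f y - s y) v\<bar>\<close> is bounded by \<open>norm (f y - s y)\<close> itself, so the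
  bound passes to the integrals by monotonicity alone. Pulling a constant
  out of the integral of \<open>norm (f y - s y)\<close> would need the measurability of a difference, which is
  delicate in a nonseparable space; the factor \<open>norm v\<close> of a general \<open>v\<close> is therefore put back on
  the scalar side.
\<close>

lemma has_vector_integral_inner:
  assumes "has_vector_integral M f x"
  shows "has_bochner_integral M (\<lambda>y. inner (f y) v) (inner x v)"
proof -
  have unit: "has_bochner_integral M (\<lambda>y. inner (f y) u) (inner x u)" if u: "norm u \<le> 1" for u
  proof -
    obtain s where f: "f \<in> borel_measurable M"
      and s: "\<And>i. Bochner_Integration.simple_bochner_integrable M (s i)"
      and err: "(\<lambda>i. \<integral>\<^sup>+ y. norm (f y - s i y) \<partial>M) \<longlonglongrightarrow> 0"
      and lim: "(\<lambda>i. Bochner_Integration.simple_bochner_integral M (s i)) \<longlonglongrightarrow> x"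
      using assms unfolding has_vector_integral_def by blast
    have le: "norm (inner (f y) u - inner (s i y) u) \<le> norm (f y - s i y)" for i y
    proof -
      have "\<bar>inner (f y - s i y) u\<bar> \<le> norm (f y - s i y) * norm u"
        by (rule Cauchy_Schwarz_ineq2)
      also have "\<dots> \<le> norm (f y - s i y)"
        using u by (simp add: mult_left_le)
      finally show ?thesis
        by (simp add: inner_diff_left)
    qed
    show ?thesis
    proof (rule has_bochner_integral.intros)
      show "(\<lambda>y. inner (f y) u) \<in> borel_measurable M"
        by (rule measurable_compose[OF f])
          (intro borel_measurable_continuous_onI continuous_intros)
      show "Bochner_Integration.simple_bochner_integrable M (\<lambda>y. inner (s i y) u)" for i
        by (rule Bochner_Integration.simple_bochner_integrable_compose2
            [where p = "\<lambda>a b. inner a u", OF _ s s]) simp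
      show "(\<lambda>i. \<integral>\<^sup>+ y. norm (inner (f y) u - inner (s i y) u) \<partial>M) \<longlonglongrightarrow> 0"
        by (rule tendsto_sandwich[OF _ _ tendsto_const err])
          (auto intro!: always_eventually nn_integral_mono ennreal_leI simp del: real_norm_def
            intro: le)
      have "linear (\<lambda>a. inner a u)"
        by (rule linearI) (auto simp: inner_add_left)
      then have "Bochner_Integration.simple_bochner_integral M (\<lambda>y. inner (s i y) u) =
          inner (Bochner_Integration.simple_bochner_integral M (s i)) u" for i
        by (rule Bochner_Integration.simple_bochner_integral_linear[OF _ s])
      then show "(\<lambda>i. Bochner_Integration.simple_bochner_integral M (\<lambda>y. inner (s i y) u))
          \<longlonglongrightarrow> inner x u"
        using tendsto_inner[OF lim tendsto_const[of u]] by simp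
    qed
  qed
  have "has_bochner_integral M (\<lambda>y. norm v * inner (f y) (sgn v)) (norm v * inner x (sgn v))"
    by (intro has_bochner_integral_mult_right unit) (simp add: norm_sgn)
  moreover have "norm v * inner a (sgn v) = inner a v" for a
    by (cases "v = 0") (simp_all add: sgn_div_norm)
  ultimately show ?thesis
    by simp
qed


section \<open>Cocycles of orthogonal representations\<close>

context
  fixes \<rho> :: "'g::topological_group_add \<Rightarrow> 'r::real_inner \<Rightarrow> 'r"
  assumes rep: "orthogonal_representation \<rho>"
begin

lemma representation_linear: "linear (\<rho> g)"
  and representation_inner: "inner (\<rho> g v) (\<rho> g w) = inner v w"
  and representation_0: "\<rho> 0 v = v"
  and representation_add: "\<rho> (g + h) v = \<rho> g (\<rho> h v)"
  and representation_continuous: "continuous_on UNIV (\<lambda>g. \<rho> g v)"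
  using rep by (simp_all add: orthogonal_representation_def)

lemma representation_norm: "norm (\<rho> g v) = norm v"
  by (simp add: norm_eq_sqrt_inner representation_inner)

lemma representation_adjoint: "inner (\<rho> g v) w = inner v (\<rho> (- g) w)"
  using representation_inner[of g v "\<rho> (- g) w"]
  by (simp add: representation_0 flip: representation_add)

lemma cocycle_add: "b \<in> cocycles \<rho> \<Longrightarrow> b (g + h) = b g + \<rho> g (b h)"
  and cocycle_continuous: "b \<in> cocycles \<rho> \<Longrightarrow> continuous_on UNIV b"
  by (simp_all add: cocycles_def)

lemma cocycle_0: "b \<in> cocycles \<rho> \<Longrightarrow> b 0 = 0"
  using cocycle_add[of b 0 0] by (simp add: representation_0)

lemma cocycle_uminus: "b \<in> cocycles \<rho> \<Longrightarrow> \<rho> (- g) (b g) = - b (- g)"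
  using cocycle_add[of b "- g" g] by (simp add: cocycle_0 add_eq_0_iff)

lemma coboundary_cocycle: "coboundary \<rho> v \<in> cocycles \<rho>"
  using representation_linear
  by (auto simp: cocycles_def coboundary_def representation_add linear_diff
      intro!: continuous_intros representation_continuous)

lemma cocycle_diff:
  assumes "b \<in> cocycles \<rho>" "c \<in> cocycles \<rho>"
  shows "(\<lambda>g. b g - c g) \<in> cocycles \<rho>"
  using assms representation_linear
  by (auto simp: cocycles_def linear_diff intro!: continuous_intros)

lemma cocycle_compose_intertwiner:
  assumes "b \<in> cocycles \<rho>" "bounded_linear T" "\<And>g v. T (\<rho> g v) = \<rho> g (T v)"
  shows "(\<lambda>g. T (b g)) \<in> cocycles \<rho>"
  unfolding cocycles_def
proof (intro CollectI conjI allI)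
  show "continuous_on UNIV (\<lambda>g. T (b g))"
    by (rule bounded_linear.continuous_on[OF assms(2) cocycle_continuous[OF assms(1)]])
  show "T (b (g + h)) = T (b g) + \<rho> g (T (b h))" for g h
    by (simp add: cocycle_add[OF assms(1)] linear_add[OF bounded_linear.linear[OF assms(2)]] assms(3))
qed

lemma cocycle_vanishes_on_generated_subgroup:
  assumes b: "b \<in> cocycles \<rho>" and S: "\<And>s. s \<in> S \<Longrightarrow> b s = 0"
    and "g \<in> generated_subgroup S"
  shows "b g = 0"
  using assms(3)
proof induction
  case (uminus s)
  then show ?case
    using cocycle_uminus[OF b, of s] linear_0[OF representation_linear] by simp
qed (simp_all add: S cocycle_0 cocycle_add b linear_0[OF representation_linear])

text \<open>
  The orbit differences \<open>\<rho> g (b h) = b (g + h) - b g\<close> stay in the span of the values of \<open>b\<close>.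
\<close>

lemma cocycle_closed_span_invariant:
  assumes b: "b \<in> cocycles \<rho>" and "w \<in> closure (span (range b))"
  shows "\<rho> g w \<in> closure (span (range b))"
proof -
  have "\<rho> g u \<in> span (range b)" if "u \<in> span (range b)" for u
    using that
  proof (induction rule: span_induct_alt)
    case base
    then show ?case
      by (simp add: linear_0[OF representation_linear] span_zero)
  next
    case (step c x y)
    then obtain h where "x = b h"
      by blast
    then have "\<rho> g x = b (g + h) - b g"
      by (simp add: cocycle_add[OF b])
    then have "\<rho> g x \<in> span (range b)"
      by (simp add: span_base span_diff)
    then show ?case
      using step by (simp add: linear_add linear_scale representation_linear span_add span_scale)
  qed
  moreover have "bounded_linear (\<rho> g)"
    using representation_linear[of g] representation_norm
    by (intro bounded_linear.intro linear.axioms bounded_linear_axioms.intro)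
      (auto simp: linear_def intro: exI[of _ 1])
  ultimately show ?thesis
    using assms(2) closure_bounded_linear_image_subset[of "\<rho> g" "span (range b)"]
      closure_mono[of "\<rho> g ` span (range b)" "span (range b)"] by blast
qed

lemma cocycle_norm_le_set_power:
  assumes b: "b \<in> cocycles \<rho>" and M: "\<And>q. q \<in> Q \<Longrightarrow> norm (b q) \<le> M"
    and "g \<in> set_power Q n"
  shows "norm (b g) \<le> real n * M"
  using assms(3)
proof (induction n arbitrary: g)
  case 0
  then show ?case
    by (simp add: cocycle_0[OF b])
next
  case (Suc n)
  then obtain x y where g: "g = x + y" and "x \<in> Q" "y \<in> set_power Q n"
    by auto
  have "norm (b g) \<le> norm (b x) + norm (b y)"
    using norm_triangle_ineq[of "b x" "\<rho> x (b y)"]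
    by (simp add: g cocycle_add[OF b] representation_norm)
  also have "\<dots> \<le> M + real n * M"
    using M[OF \<open>x \<in> Q\<close>] Suc.IH[OF \<open>y \<in> set_power Q n\<close>] by linarith
  finally show ?case
    by (simp add: algebra_simps)
qed

end

lemma set_power_add:
  "x \<in> set_power Q m \<Longrightarrow> y \<in> set_power Q n \<Longrightarrow> x + y \<in> set_power Q (m + n)"
proof (induction m arbitrary: x)
  case (Suc m)
  then obtain q z where x: "x = q + z" and q: "q \<in> Q" and "z \<in> set_power Q m"
    by auto
  then have "z + y \<in> set_power Q (m + n)"
    using Suc by blast
  with q have "q + (z + y) \<in> set_power Q (Suc (m + n))"
    unfolding set_power.simps by blast
  then show ?case
    by (simp only: x add.assoc add_Suc)
qed simp

lemma mem_set_power_1: "q \<in> Q \<Longrightarrow> q \<in> set_power Q 1"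
  by simp

lemma set_power_uminus:
  assumes "uminus ` Q = Q"
  shows "x \<in> set_power Q n \<Longrightarrow> - x \<in> set_power Q n"
proof (induction n arbitrary: x)
  case (Suc n)
  then obtain q z where x: "x = q + z" and "q \<in> Q" "z \<in> set_power Q n"
    by auto
  then have "- q \<in> set_power Q 1"
    using assms by (intro mem_set_power_1) blast
  from set_power_add[OF Suc.IH[OF \<open>z \<in> set_power Q n\<close>] this] show ?case
    by (simp add: x minus_add)
qed simp

lemma mem_set_power_word_length:
  assumes "uminus ` Q = Q" and "g \<in> generated_subgroup Q"
  shows "g \<in> set_power Q (word_length Q g)"
proof -
  from assms(2) have "\<exists>n. g \<in> set_power Q n"
  proof induction
    case zero
    have "0 \<in> set_power Q 0"
      by simp
    then show ?case ..
  next
    case (base s)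
    from mem_set_power_1[OF this] show ?case ..
  next
    case (add s t)
    then show ?case
      using set_power_add[of s Q _ t] by blast
  next
    case (uminus s)
    then show ?case
      using set_power_uminus[OF assms(1)] by blast
  qed
  then show ?thesis
    unfolding word_length_def by (rule LeastI_ex)
qed

lemma cocycle_norm_le_word_length:
  assumes "orthogonal_representation \<rho>" "compact_generating_nbhd Q" "b \<in> cocycles \<rho>"
    and "\<And>q. q \<in> Q \<Longrightarrow> norm (b q) \<le> M"
  shows "norm (b g) \<le> real (word_length Q g) * M"
proof (rule cocycle_norm_le_set_power[OF assms(1,3)])
  show "g \<in> set_power Q (word_length Q g)"
    using assms(2) by (intro mem_set_power_word_length) (auto simp: compact_generating_nbhd_def)
qed (rule assms(4))

lemma cocycle_bounded_on_compact:
  assumes "orthogonal_representation \<rho>" "compact Q" "b \<in> cocycles \<rho>"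
  obtains M where "0 \<le> M" "\<And>q. q \<in> Q \<Longrightarrow> norm (b q) \<le> M"
proof -
  have "bounded (b ` Q)"
    using cocycle_continuous[OF assms(1,3)] assms(2)
    by (meson compact_continuous_image compact_imp_bounded continuous_on_subset subset_UNIV)
  then obtain M where "\<forall>x\<in>b ` Q. norm x \<le> M"
    by (auto simp: bounded_iff)
  then show ?thesis
    by (intro that[of "max M 0"]) (auto simp: le_max_iff_disj)
qed

lemma orthogonal_part_intertwines:
  fixes W :: "'r::{real_inner, complete_space} set"
  assumes rep: "orthogonal_representation \<rho>" and W: "subspace W" "closed W"
    and inv: "\<And>g w. w \<in> W \<Longrightarrow> \<rho> g w \<in> W"
  shows "orthogonal_part W (\<rho> g x) = \<rho> g (orthogonal_part W x)"
proof (rule orthogonal_part_unique[OF W])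
  show "inner (\<rho> g (orthogonal_part W x)) w = 0" if "w \<in> W" for w
    by (simp add: representation_adjoint[OF rep] inner_orthogonal_part[OF W] inv that)
  show "\<rho> g x - \<rho> g (orthogonal_part W x) \<in> W"
    using inv[OF diff_orthogonal_part[OF W]]
    by (simp add: linear_diff[OF representation_linear[OF rep]])
qed


section \<open>Harmonic cocycles are orthogonal to coboundaries\<close>

text \<open>
  Harmonicity is stated weakly, tested against vectors, because in this form it passes from a
  cocycle to its orthogonal projections. In \<open>inner (h x) (\<rho> x v - v)\<close> the second term integrates
  to \<open>0\<close> by harmonicity, and the first one equals \<open>- inner (h (- x)) v\<close>, whose integral is \<open>0\<close>
  because \<open>\<mu>\<close> is symmetric.
\<close>

lemma harmonic_cocycle_orthogonal_coboundary:
  assumes rep: "orthogonal_representation \<rho>"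
    and sets: "sets \<mu> = sets borel" and sym: "distr \<mu> borel uminus = \<mu>"
    and h: "h \<in> cocycles \<rho>"
    and harm: "\<And>v. has_bochner_integral \<mu> (\<lambda>x. inner (h x) v) 0"
  shows "(\<integral>x. inner (h x) (coboundary \<rho> v x) \<partial>\<mu>) = 0"
proof -
  have um: "(uminus :: 'a \<Rightarrow> 'a) \<in> measurable \<mu> borel"
    unfolding measurable_cong_sets[OF sets refl]
    by (intro borel_measurable_continuous_onI continuous_intros)
  have hm: "(\<lambda>x. inner (h x) v) \<in> borel_measurable borel"
    by (intro borel_measurable_continuous_onI continuous_intros cocycle_continuous[OF rep h])
  have int: "integrable \<mu> (\<lambda>x. inner (h x) v)" "(\<integral>x. inner (h x) v \<partial>\<mu>) = 0"
    using harm by (auto simp: has_bochner_integral_iff)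
  have "integrable \<mu> (\<lambda>x. inner (h (- x)) v)" "(\<integral>x. inner (h (- x)) v \<partial>\<mu>) = 0"
    using int integrable_distr_eq[OF um hm] integral_distr[OF um hm] by (simp_all add: sym)
  moreover have "inner (h x) (coboundary \<rho> v x) = - inner (h (- x)) v - inner (h x) v" for x
    using representation_adjoint[OF rep, of "- x" "h x" v] cocycle_uminus[OF rep h, of x]
    by (simp add: coboundary_def inner_diff_right)
  ultimately show ?thesis
    using int by simp
qed

text \<open>
  With \<open>k = h - \<partial>v\<close> small on \<open>Q\<close>, orthogonality to \<open>\<partial>v\<close> gives \<open>\<integral>\<bar>h\<bar>\<^sup>2 = \<integral>\<langle>h, k\<rangle>\<close>, and each
  factor is at most the word length, a square-integrable function, times its bound on \<open>Q\<close>.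
\<close>

lemma harmonic_limit_of_coboundaries_eq_0:
  assumes rep: "orthogonal_representation \<rho>"
    and Q: "compact_generating_nbhd Q" and adapted: "cohomologically_adapted Q \<nu> \<mu>"
    and h: "h \<in> cocycles \<rho>"
    and harm: "\<And>v. has_bochner_integral \<mu> (\<lambda>x. inner (h x) v) 0"
    and approx: "\<And>e. 0 < e \<Longrightarrow> \<exists>v. \<forall>q\<in>Q. norm (h q - coboundary \<rho> v q) \<le> e"
  shows "h g = 0"
proof -
  have sets: "sets \<mu> = sets borel" and sym: "distr \<mu> borel uminus = \<mu>"
    and supp: "generated_subgroup (measure_support \<mu>) = UNIV"
    and wl: "integrable \<mu> (\<lambda>x. (real (word_length Q x))\<^sup>2)"
    using adapted by (auto simp: cohomologically_adapted_def)
  define L where "L = (\<integral>x. (real (word_length Q x))\<^sup>2 \<partial>\<mu>)"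
  have L0: "0 \<le> L"
    by (simp add: L_def)
  have space: "space \<mu> = UNIV"
    using sets_eq_imp_space_eq[OF sets] by simp
  have meas: "f \<in> borel_measurable \<mu>" if "continuous_on UNIV f" for f :: "'a \<Rightarrow> real"
    unfolding measurable_cong_sets[OF sets refl] using that by (rule borel_measurable_continuous_onI)
  have bound: "\<bar>inner (a x) (c x)\<bar> \<le> M * N * (real (word_length Q x))\<^sup>2"
    if a: "a \<in> cocycles \<rho>" and c: "c \<in> cocycles \<rho>"
      and M: "\<And>q. q \<in> Q \<Longrightarrow> norm (a q) \<le> M" and N: "\<And>q. q \<in> Q \<Longrightarrow> norm (c q) \<le> N"
    for a c M N x
  proof -
    have "\<bar>inner (a x) (c x)\<bar> \<le> norm (a x) * norm (c x)"
      by (rule Cauchy_Schwarz_ineq2)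
    also have "\<dots> \<le> (real (word_length Q x) * M) * (real (word_length Q x) * N)"
      using cocycle_norm_le_word_length[OF rep Q a M, of x]
        cocycle_norm_le_word_length[OF rep Q c N, of x]
      by (intro mult_mono) (auto intro: order_trans[OF norm_ge_zero])
    finally show ?thesis
      by (simp add: power2_eq_square algebra_simps)
  qed
  have integrable: "integrable \<mu> (\<lambda>x. inner (a x) (c x))"
    if a: "a \<in> cocycles \<rho>" and c: "c \<in> cocycles \<rho>" for a c
  proof -
    have "compact Q"
      using Q by (simp add: compact_generating_nbhd_def)
    then obtain M N where MN: "\<And>q. q \<in> Q \<Longrightarrow> norm (a q) \<le> M" "\<And>q. q \<in> Q \<Longrightarrow> norm (c q) \<le> N"
      using cocycle_bounded_on_compact[OF rep _ a] cocycle_bounded_on_compact[OF rep _ c] by metis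
    show ?thesis
    proof (rule Bochner_Integration.integrable_bound)
      show "integrable \<mu> (\<lambda>x. M * N * (real (word_length Q x))\<^sup>2)"
        using wl by simp
      show "(\<lambda>x. inner (a x) (c x)) \<in> borel_measurable \<mu>"
        by (intro meas continuous_intros cocycle_continuous[OF rep] a c)
      show "AE x in \<mu>. norm (inner (a x) (c x)) \<le> norm (M * N * (real (word_length Q x))\<^sup>2)"
        using bound[OF a c MN] by (intro AE_I2) (simp add: order_trans[OF _ abs_ge_self])
    qed
  qed
  obtain M where M0: "0 \<le> M" and M: "\<And>q. q \<in> Q \<Longrightarrow> norm (h q) \<le> M"
    using Q cocycle_bounded_on_compact[OF rep _ h] by (auto simp: compact_generating_nbhd_def)
  have small: "(\<integral>x. inner (h x) (h x) \<partial>\<mu>) \<le> e * (M * L)" if e: "0 < e" for e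
  proof -
    obtain v where v: "\<And>q. q \<in> Q \<Longrightarrow> norm (h q - coboundary \<rho> v q) \<le> e"
      using approx[OF e] by blast
    note cob = coboundary_cocycle[OF rep, of v]
    note k = cocycle_diff[OF rep h cob]
    have "(\<integral>x. inner (h x) (h x) \<partial>\<mu>) =
        (\<integral>x. inner (h x) (h x - coboundary \<rho> v x) + inner (h x) (coboundary \<rho> v x) \<partial>\<mu>)"
      by (simp add: inner_diff_right)
    also have "\<dots> = (\<integral>x. inner (h x) (h x - coboundary \<rho> v x) \<partial>\<mu>)"
      using harmonic_cocycle_orthogonal_coboundary[OF rep sets sym h harm]
      by (subst Bochner_Integration.integral_add[OF integrable[OF h k] integrable[OF h cob]]) simp
    also have "\<dots> \<le> (\<integral>x. M * e * (real (word_length Q x))\<^sup>2 \<partial>\<mu>)"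
      using bound[OF h k M v] wl
      by (intro integral_mono integrable[OF h k]) (auto intro: abs_le_D1)
    finally show ?thesis
      by (simp add: L_def mult.assoc mult.left_commute)
  qed
  have "(\<integral>x. inner (h x) (h x) \<partial>\<mu>) \<le> 0"
  proof (rule field_le_epsilon)
    fix e :: real assume e: "0 < e"
    \<comment> \<open>The summand \<open>1\<close> keeps the denominator positive when \<open>M * L = 0\<close>.\<close>
    have "(\<integral>x. inner (h x) (h x) \<partial>\<mu>) \<le> e / (M * L + 1) * (M * L)"
      using e M0 L0 by (intro small divide_pos_pos) (auto intro: add_nonneg_pos)
    also have "\<dots> \<le> e"
      using e mult_nonneg_nonneg[OF M0 L0] by (simp add: divide_le_eq distrib_left)
    finally show "(\<integral>x. inner (h x) (h x) \<partial>\<mu>) \<le> 0 + e"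
      by simp
  qed
  then have "(\<integral>x. inner (h x) (h x) \<partial>\<mu>) = 0"
    by (intro antisym) auto
  then have ae: "AE x in \<mu>. h x = 0"
    using integral_nonneg_eq_0_iff_AE[OF integrable[OF h h]] by simp
  have "h s = 0" if s: "s \<in> measure_support \<mu>" for s
  proof (rule ccontr)
    let ?U = "{x. h x \<noteq> 0}"
    assume "h s \<noteq> 0"
    have U: "open ?U"
      by (intro open_Collect_neq cocycle_continuous[OF rep h] continuous_on_const)
    then have "0 < emeasure \<mu> ?U"
      using s \<open>h s \<noteq> 0\<close> by (auto simp: measure_support_def)
    moreover have "emeasure \<mu> ?U = 0"
      using ae U by (subst (asm) AE_iff_measurable[where N = ?U]) (auto simp: space sets)
    ultimately show False
      by simp
  qed
  then show ?thesis
    using cocycle_vanishes_on_generated_subgroup[OF rep h] supp by blast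
qed


section \<open>The reduced class\<close>

text \<open>
  For functions that are not continuous the strict inequality on \<open>Q\<close> need not define an open set;
  a uniform margin \<open>d < e\<close> makes it one.
\<close>

lemma closed_coboundaries_approx:
  assumes c: "c \<in> closed_coboundaries \<rho>" and Q: "compact Q" and e: "0 < e"
  shows "\<exists>v. \<forall>q\<in>Q. norm (c q - coboundary \<rho> v q) \<le> e"
proof -
  define U where "U = {f. \<exists>d<e. \<forall>q\<in>Q. dist (f q) (c q) \<le> d}"
  have "openin compact_convergence U"
    unfolding openin_compact_convergence
  proof
    fix f assume "f \<in> U"
    then obtain d where d: "d < e" "\<And>q. q \<in> Q \<Longrightarrow> dist (f q) (c q) \<le> d"
      unfolding U_def by blast
    have "f' \<in> U" if f': "\<forall>q\<in>Q. dist (f' q) (f q) < (e - d) / 2" for f'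
    proof -
      have "dist (f' q) (c q) \<le> (e + d) / 2" if "q \<in> Q" for q
      proof -
        have "dist (f' q) (f q) < (e - d) / 2"
          using f' that by blast
        then show ?thesis
          using d(2)[OF that] dist_triangle[of "f' q" "c q" "f q"] by (simp add: field_simps)
      qed
      then show ?thesis
        using d(1) unfolding U_def by (intro CollectI exI[of _ "(e + d) / 2"]) auto
    qed
    then show "\<exists>K r. compact K \<and> 0 < r \<and> {f'. \<forall>x\<in>K. dist (f' x) (f x) < r} \<subseteq> U"
      using Q d(1) by (intro exI[of _ Q] exI[of _ "(e - d) / 2"]) auto
  qed
  then have "openin (subtopology compact_convergence (cocycles \<rho>)) (cocycles \<rho> \<inter> U)"
    by (auto simp: openin_subtopology)
  moreover have "c \<in> cocycles \<rho> \<inter> U"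
    using c e by (auto simp: closed_coboundaries_def in_closure_of U_def intro!: exI[of _ 0])
  ultimately obtain v where "coboundary \<rho> v \<in> U"
    using c by (auto simp: closed_coboundaries_def in_closure_of coboundaries_def)
  then obtain d where "d < e" "\<And>q. q \<in> Q \<Longrightarrow> dist (coboundary \<rho> v q) (c q) \<le> d"
    by (auto simp: U_def)
  then show ?thesis
    by (intro exI[of _ v] ballI) (metis dist_commute dist_norm less_imp_le order_trans)
qed

lemma same_reduced_class_refl:
  assumes rep: "orthogonal_representation \<rho>"
  shows "same_reduced_class \<rho> b b"
proof -
  have "coboundary \<rho> 0 = (\<lambda>g. 0)"
    by (simp add: fun_eq_iff coboundary_def linear_0[OF representation_linear[OF rep]])
  then have "(\<lambda>g. 0) \<in> coboundaries \<rho>" "(\<lambda>g. 0) \<in> cocycles \<rho>"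
    using coboundary_cocycle[OF rep, of 0] by (auto simp: coboundaries_def image_iff) metis
  moreover have "openin compact_convergence UNIV"
    unfolding openin_compact_convergence by (auto intro!: exI[of _ "{}"] exI[of _ "1::real"])
  then have "topspace compact_convergence = UNIV"
    using openin_subset by blast
  ultimately show ?thesis
    by (auto simp: same_reduced_class_def closed_coboundaries_def in_closure_of)
qed

text \<open>
  The complement component of \<open>b\<close> relative to the closed invariant subspace \<open>W\<close> generated by \<open>b'\<close> is
  minus that of \<open>b' - b\<close>, so it is both harmonic and a limit of coboundaries.
\<close>

lemma harmonic_cocycle_in_closed_span:
  fixes \<rho> :: "'g::{topological_group_add, t2_space} \<Rightarrow> 'r::{real_inner, complete_space} \<Rightarrow> 'r"
  assumes rep: "orthogonal_representation \<rho>"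
    and Q: "compact_generating_nbhd Q" and adapted: "cohomologically_adapted Q \<nu> \<mu>"
    and harm: "b \<in> harmonic_cocycles \<mu> \<rho>"
    and b': "b' \<in> cocycles \<rho>" and same: "same_reduced_class \<rho> b b'"
  shows "b g \<in> closure (span (range b'))"
proof -
  define W where "W = closure (span (range b'))"
  define P where "P = orthogonal_part W"
  have W: "subspace W" "closed W"
    by (auto simp: W_def intro: subspace_closure)
  have b: "b \<in> cocycles \<rho>" and int: "has_vector_integral \<mu> b 0"
    using harm by (auto simp: harmonic_cocycles_def)
  have P_rep: "P (\<rho> g v) = \<rho> g (P v)" for g v
    unfolding P_def
    by (rule orthogonal_part_intertwines[OF rep W])
      (simp add: W_def cocycle_closed_span_invariant[OF rep b'])
  have P: "bounded_linear P"
    unfolding P_def by (rule bounded_linear_orthogonal_part[OF W])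
  have Pb': "P (b' g) = 0" for g
    using closure_subset[of "span (range b')"] span_base[of "b' g" "range b'"]
    by (auto simp: P_def orthogonal_part_eq_0_iff[OF W] W_def[symmetric])
  have "P (b g) = 0"
  proof (rule harmonic_limit_of_coboundaries_eq_0
      [where h = "\<lambda>g. P (b g)", OF rep Q adapted])
    show "(\<lambda>g. P (b g)) \<in> cocycles \<rho>"
      by (rule cocycle_compose_intertwiner[OF rep b P P_rep])
    show "has_bochner_integral \<mu> (\<lambda>x. inner (P (b x)) v) 0" for v
      using has_vector_integral_inner[OF int, of "P v"]
      by (simp add: P_def orthogonal_part_selfadjoint[OF W])
    show "\<exists>v. \<forall>q\<in>Q. norm (P (b q) - coboundary \<rho> v q) \<le> e" if e: "0 < e" for e
    proof -
      have "compact Q"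
        using Q by (simp add: compact_generating_nbhd_def)
      from closed_coboundaries_approx[OF same[unfolded same_reduced_class_def] this e]
      obtain v where v: "\<And>q. q \<in> Q \<Longrightarrow> norm (b' q - b q - coboundary \<rho> v q) \<le> e"
        by metis
      have "norm (P (b q) - coboundary \<rho> (P (- v)) q) \<le> e" if "q \<in> Q" for q
      proof -
        have "P (b q) - coboundary \<rho> (P (- v)) q = - P (b' q - b q - coboundary \<rho> v q)"
          using P representation_linear[OF rep]
          by (simp add: coboundary_def linear_diff linear_neg bounded_linear.linear P_rep Pb')
        then have "norm (P (b q) - coboundary \<rho> (P (- v)) q)
            \<le> norm (b' q - b q - coboundary \<rho> v q)"
          by (simp add: P_def norm_orthogonal_part_le[OF W])
        then show ?thesis
          using v[OF that] by linarith
      qed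
      then show ?thesis
        by blast
    qed
  qed
  then show ?thesis
    using orthogonal_part_eq_0_iff[OF W, of "b g"] by (simp add: P_def flip: W_def)
qed


section \<open>Closed complex spans and unitary representations\<close>

lemma norm_scaleC: "norm (scaleC a x) = cmod a * norm x" for x :: "'a::complex_inner"
proof -
  have "cinner x x = complex_of_real (inner x x)"
    using cinner_commute[of x x] by (simp add: complex_eq_iff Re_cinner)
  then have "cinner (scaleC a x) (scaleC a x) = a * cnj (a * complex_of_real (inner x x))"
    using cinner_commute[of "scaleC a x" x] by (simp add: cinner_scaleC_right)
  also have "\<dots> = complex_of_real ((cmod a)\<^sup>2 * inner x x)"
    using complex_norm_square[of a] by simp
  finally have "inner (scaleC a x) (scaleC a x) = (cmod a)\<^sup>2 * inner x x"
    using Re_cinner[of "scaleC a x" "scaleC a x"] by simp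
  then show ?thesis
    by (simp add: norm_eq_sqrt_inner real_sqrt_mult)
qed

lemma bounded_linear_scaleC: "bounded_linear (scaleC a :: 'a::complex_inner \<Rightarrow> 'a)"
proof
  show "scaleC a (r *\<^sub>R x) = r *\<^sub>R scaleC a x" for r and x :: 'a
    by (simp add: scaleC_scaleC mult.commute flip: scaleC_of_real)
qed (auto simp: scaleC_add_right norm_scaleC intro: exI[of _ "cmod a"])

lemma complex_subspace_imp_subspace:
  "module.subspace scaleC S \<Longrightarrow> subspace S" for S :: "'a::complex_inner set"
  by (metis module.subspace_def module_scaleC scaleC_of_real subspaceI)

lemma complex_subspace_closure:
  fixes S :: "'a::complex_inner set"
  assumes S: "module.subspace scaleC S"
  shows "module.subspace scaleC (closure S)"
proof -
  have "subspace (closure S)"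
    by (intro subspace_closure complex_subspace_imp_subspace S)
  moreover have "scaleC a x \<in> closure S" if "x \<in> closure S" for a x
  proof -
    have "scaleC a ` S \<subseteq> S"
      using module.subspace_scale[OF module_scaleC S] by blast
    then show ?thesis
      using closure_bounded_linear_image_subset[OF bounded_linear_scaleC, of a S] that
        closure_mono by blast
  qed
  ultimately show ?thesis
    unfolding module.subspace_def[OF module_scaleC]
    by (auto intro: subspace_0 subspace_add)
qed

lemma span_subset_cspan: "span S \<subseteq> cspan S"
  unfolding cspan_def
  by (intro span_minimal complex_subspace_imp_subspace module.subspace_span[OF module_scaleC]
      module.span_superset[OF module_scaleC])

lemma closure_cspan_subsetI:
  assumes "S \<subseteq> closure (cspan T)"
  shows "closure (cspan S) \<subseteq> closure (cspan T)"
proof (rule closure_minimal)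
  show "cspan S \<subseteq> closure (cspan T)"
    using assms unfolding cspan_def
    by (intro module.span_minimal[OF module_scaleC] complex_subspace_closure
        module.subspace_span[OF module_scaleC])
qed simp

lemma unitary_imp_orthogonal_representation:
  assumes "unitary_representation \<pi>"
  shows "orthogonal_representation \<pi>"
proof -
  have "linear (\<pi> g)" for g
  proof (rule linearI)
    have hom: "module_hom scaleC scaleC (\<pi> g)"
      using assms by (simp add: unitary_representation_def)
    show "\<pi> g (v + w) = \<pi> g v + \<pi> g w" for v w
      by (rule module_hom.add[OF hom])
    show "\<pi> g (r *\<^sub>R v) = r *\<^sub>R \<pi> g v" for r v
      using module_hom.scale[OF hom] by (simp flip: scaleC_of_real)
  qed
  moreover have "inner (\<pi> g v) (\<pi> g w) = inner v w" for g v w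
    using assms by (simp add: unitary_representation_def flip: Re_cinner)
  ultimately show ?thesis
    using assms by (simp add: unitary_representation_def orthogonal_representation_def)
qed

theorem theorem1:
  fixes Q :: "'g::{topological_group_add, t2_space} set"
    and \<nu> \<mu> :: "'g measure"
    and \<rho> :: "'g \<Rightarrow> 'r::{real_inner, complete_space} \<Rightarrow> 'r"
    and \<pi> :: "'g \<Rightarrow> 'c::{complex_inner, complete_space} \<Rightarrow> 'c"
  assumes "locally_compact_space (euclidean :: 'g topology)"
    and "compact_generating_nbhd Q"
    and "left_haar_measure \<nu>"
    and "cohomologically_adapted Q \<nu> \<mu>"
  shows "(orthogonal_representation \<rho> \<longrightarrow>
      (\<forall>b \<in> harmonic_cocycles \<mu> \<rho>.
        closure (span (range b)) =
          (\<Inter>b' \<in> {b' \<in> cocycles \<rho>. same_reduced_class \<rho> b b'}. closure (span (range b'))))) \<and>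
    (unitary_representation \<pi> \<longrightarrow>
      (\<forall>b \<in> harmonic_cocycles \<mu> \<pi>.
        closure (cspan (range b)) =
          (\<Inter>b' \<in> {b' \<in> cocycles \<pi>. same_reduced_class \<pi> b b'}. closure (cspan (range b')))))"
proof (intro conjI impI ballI)
  fix b assume rep: "orthogonal_representation \<rho>" and b: "b \<in> harmonic_cocycles \<mu> \<rho>"
  show "closure (span (range b)) =
      (\<Inter>b' \<in> {b' \<in> cocycles \<rho>. same_reduced_class \<rho> b b'}. closure (span (range b')))"
  proof
    show "closure (span (range b)) \<subseteq>
        (\<Inter>b' \<in> {b' \<in> cocycles \<rho>. same_reduced_class \<rho> b b'}. closure (span (range b')))"
    proof (intro INT_greatest closure_minimal span_minimal closed_closure)
      fix b' assume "b' \<in> {b' \<in> cocycles \<rho>. same_reduced_class \<rho> b b'}"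
      then show "range b \<subseteq> closure (span (range b'))"
        using harmonic_cocycle_in_closed_span[OF rep assms(2,4) b] by blast
      show "subspace (closure (span (range b')))"
        by (intro subspace_closure subspace_span)
    qed
    show "(\<Inter>b' \<in> {b' \<in> cocycles \<rho>. same_reduced_class \<rho> b b'}. closure (span (range b')))
        \<subseteq> closure (span (range b))"
      using b same_reduced_class_refl[OF rep] by (intro INT_lower) (auto simp: harmonic_cocycles_def)
  qed
next
  fix b assume "unitary_representation \<pi>" and b: "b \<in> harmonic_cocycles \<mu> \<pi>"
  then have rep: "orthogonal_representation \<pi>"
    by (intro unitary_imp_orthogonal_representation)
  show "closure (cspan (range b)) =
      (\<Inter>b' \<in> {b' \<in> cocycles \<pi>. same_reduced_class \<pi> b b'}. closure (cspan (range b')))"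
  proof
    show "closure (cspan (range b)) \<subseteq>
        (\<Inter>b' \<in> {b' \<in> cocycles \<pi>. same_reduced_class \<pi> b b'}. closure (cspan (range b')))"
    proof (intro INT_greatest closure_cspan_subsetI)
      fix b' assume "b' \<in> {b' \<in> cocycles \<pi>. same_reduced_class \<pi> b b'}"
      then have "range b \<subseteq> closure (span (range b'))"
        using harmonic_cocycle_in_closed_span[OF rep assms(2,4) b] by blast
      then show "range b \<subseteq> closure (cspan (range b'))"
        using closure_mono[OF span_subset_cspan] by blast
    qed
    show "(\<Inter>b' \<in> {b' \<in> cocycles \<pi>. same_reduced_class \<pi> b b'}. closure (cspan (range b')))
        \<subseteq> closure (cspan (range b))"
      using b same_reduced_class_refl[OF rep] by (intro INT_lower) (auto simp: harmonic_cocycles_def)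
  qed
qed

end
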